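(* Let $A\in\mathbb{R}^{m\times n}$, $b\in\mathbb{R}^m$, let $c\in\mathbb{R}^{n}$ be a row vector, let $d\in\mathbb{R}^n$ be a row vector with $d_j>0$ for all $j$, let $x^0$ be a point of $\mathcal{F}_0=\{x\in\mathbb{R}^n : Ax=b,\ x\ge 0\}$, and let $K\in\mathbb{R}$. Put $J=\{j : x^0_j=0\}$ and $\bar J=\{j : x^0_j>0\}$, and let $A_j$ denote the $j$-th column of $A$. If $(\pi^*,\bar c^* )$ is an optimal solution of the problem $$\min_{\pi\in\mathbb{R}^m,\ \bar c\in\mathbb{R}^n}\ \sum_{j=1}^n d_j|\bar c_j-c_j|\quad\text{s.t.}\quad \pi A_j\le \bar c_j\ (j\in J),\qquad \pi A_j=\bar c_j\ (j\in\bar J),\qquad \bar c x^0=K,$$ then $\bar c^*$ is an optimal solution of the restricted inverse optimal value problem $(RIOVLP_1)$.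
   Context: The restricted inverse optimal value problem on linear programming under weighted $l_1$ norm, $(RIOVLP_1)$, is $$\min_{\bar c\in\mathbb{R}^n}\ \sum_{j=1}^n d_j|\bar c_j-c_j|\quad\text{s.t.}\quad \min_{x\in\mathcal{F}_0}\bar c x=K,\qquad \bar c x^0=K,$$ i.e. $c$ is modified at minimum weighted $l_1$ cost so that $x^0$ becomes an optimal solution of $\min\{\bar c x: Ax=b,\ x\ge 0\}$ with optimal value $K$. Cost vectors and $\pi$ are row vectors; $x$, $x^0$, $b$ are column vectors. It is assumed that $m<n$. *)

theory Defs
  imports "HOL-Analysis.Analysis"
begin

text \<open>Row and column vectors are both of type \<open>real ^ 'n\<close> (or \<open>real ^ 'm\<close>); the product of a
  row vector with a column vector is the inner product. Optimal solutions of minimisation problems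
  are expressed by the library predicate \<^const>\<open>is_arg_min\<close>.\<close>

definition lp_feasible :: "real ^ 'n ^ 'm \<Rightarrow> real ^ 'm \<Rightarrow> (real ^ 'n) set" where
  "lp_feasible A b = {x. A *v x = b \<and> (\<forall>j. 0 \<le> x $ j)}"

definition weighted_l1_cost :: "real ^ 'n \<Rightarrow> real ^ 'n \<Rightarrow> real ^ 'n \<Rightarrow> real" where
  "weighted_l1_cost d c c' = (\<Sum>j\<in>UNIV. d $ j * \<bar>c' $ j - c $ j\<bar>)"

text \<open>The minimum has to be attained: \<open>is_min_value f S v\<close> is false if \<open>S\<close> is empty or
  \<open>f\<close> has no minimiser on \<open>S\<close>.\<close>

definition is_min_value :: "('a \<Rightarrow> real) \<Rightarrow> 'a set \<Rightarrow> real \<Rightarrow> bool" where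
  "is_min_value f S v \<longleftrightarrow> (\<exists>x. is_arg_min f (\<lambda>y. y \<in> S) x \<and> f x = v)"

definition riovlp_feasible ::
  "real ^ 'n ^ 'm \<Rightarrow> real ^ 'm \<Rightarrow> real ^ 'n \<Rightarrow> real \<Rightarrow> real ^ 'n \<Rightarrow> bool" where
  "riovlp_feasible A b x0 K c' \<longleftrightarrow>
     is_min_value (\<lambda>x. c' \<bullet> x) (lp_feasible A b) K \<and> c' \<bullet> x0 = K"

definition riovlp1_optimal ::
  "real ^ 'n ^ 'm \<Rightarrow> real ^ 'm \<Rightarrow> real ^ 'n \<Rightarrow> real ^ 'n \<Rightarrow> real ^ 'n \<Rightarrow> real \<Rightarrow> real ^ 'n \<Rightarrow> bool"
where
  "riovlp1_optimal A b c d x0 K c' \<longleftrightarrow>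
     is_arg_min (weighted_l1_cost d c) (riovlp_feasible A b x0 K) c'"

definition dual_feasible ::
  "real ^ 'n ^ 'm \<Rightarrow> real ^ 'n \<Rightarrow> real \<Rightarrow> real ^ 'm \<Rightarrow> real ^ 'n \<Rightarrow> bool" where
  "dual_feasible A x0 K p c' \<longleftrightarrow>
     (\<forall>j \<in> {j. x0 $ j = 0}. p \<bullet> column j A \<le> c' $ j) \<and>
     (\<forall>j \<in> {j. x0 $ j > 0}. p \<bullet> column j A = c' $ j) \<and>
     c' \<bullet> x0 = K"

definition dual_problem_optimal ::
  "real ^ 'n ^ 'm \<Rightarrow> real ^ 'n \<Rightarrow> real ^ 'n \<Rightarrow> real ^ 'n \<Rightarrow> real \<Rightarrow> real ^ 'm \<Rightarrow> real ^ 'n \<Rightarrow> bool"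
where
  "dual_problem_optimal A c d x0 K p c' \<longleftrightarrow>
     is_arg_min (\<lambda>(q, e). weighted_l1_cost d c e) (\<lambda>(q, e). dual_feasible A x0 K q e) (p, c')"

end

theory Submission
  imports Defs
begin

text \<open>A cost vector makes \<open>x0\<close> optimal exactly when some dual vector satisfies the complementary
  slackness conditions, so both problems minimise the same objective over the same cost vectors.
  The existence of the dual vector is Farkas' lemma for the cone generated by the rows of \<open>A\<close>, their
  negatives, and the unit vectors at the zero coordinates of \<open>x0\<close>: a hyperplane separating the cost
  vector from this cone yields a feasible direction at \<open>x0\<close> along which the cost decreases.\<close>

text \<open>A finitely generated cone is closed, so strict separation applies; the separating level
  is negative because the cone contains 0. Homogeneity then moves the bound on the generators from
  that level up to 0.\<close>

lemma farkas_convex_cone_hull: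
  fixes S :: "'a::euclidean_space set"
  assumes "finite S" and "z \<notin> convex_cone hull S"
  obtains a where "a \<bullet> z < 0" and "\<And>x. x \<in> S \<Longrightarrow> 0 \<le> a \<bullet> x"
proof -
  obtain a \<beta> where a: "a \<bullet> z < \<beta>" "\<And>x. x \<in> convex_cone hull S \<Longrightarrow> \<beta> < a \<bullet> x"
    using separating_hyperplane_closed_point[OF convex_convex_cone_hull
        closed_convex_cone_hull[OF assms(1)] assms(2)] by blast
  have "\<beta> < 0"
    using a(2)[OF convex_cone_hull_contains_0] by simp
  \<comment> \<open>If \<open>a \<bullet> x\<close> were negative, the positive multiple of
    \<open>x\<close> by \<open>\<beta> / (a \<bullet> x)\<close> would lie in the cone and attain
    the value \<open>\<beta>\<close> exactly, against the strict bound.\<close>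
  have "0 \<le> a \<bullet> x" if "x \<in> S" for x
  proof (rule ccontr)
    assume "\<not> 0 \<le> a \<bullet> x"
    with \<open>\<beta> < 0\<close> have "(\<beta> / (a \<bullet> x)) *\<^sub>R x \<in> convex_cone hull S"
      using that by (intro convex_cone_hull_mul hull_inc) (auto simp: divide_nonpos_neg)
    from a(2)[OF this] \<open>\<not> 0 \<le> a \<bullet> x\<close> show False by simp
  qed
  moreover have "a \<bullet> z < 0"
    using a(1) \<open>\<beta> < 0\<close> by linarith
  ultimately show ?thesis by (rule that[rotated])
qed

lemma lp_feasible_small_step:
  assumes "x0 \<in> lp_feasible A b" and "A *v h = 0" and "\<And>j. x0 $ j = 0 \<Longrightarrow> 0 \<le> h $ j"
  obtains t where "0 < t" and "x0 + t *\<^sub>R h \<in> lp_feasible A b"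
proof -
  have x0: "A *v x0 = b" "\<And>j. 0 \<le> x0 $ j"
    using assms(1) by (auto simp: lp_feasible_def)
  \<comment> \<open>Each coordinate survives all small positive steps: zero ones by the sign of
    \<open>h\<close>, positive ones by continuity. Finiteness of the index type then yields a common
    step, replacing an explicit minimum ratio.\<close>
  have "\<forall>\<^sub>F t in at_right 0. 0 \<le> (x0 + t *\<^sub>R h) $ j" for j
  proof (cases "x0 $ j = 0")
    case True
    then show ?thesis
      using assms(3)[of j] by (auto simp: eventually_at_filter)
  next
    case False
    have "((\<lambda>t. (x0 + t *\<^sub>R h) $ j) \<longlongrightarrow> (x0 + 0 *\<^sub>R h) $ j) (at_right 0)"
      by (intro tendsto_intros)
    moreover have "0 < (x0 + 0 *\<^sub>R h) $ j"
      using False x0(2)[of j] by simp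
    ultimately have "\<forall>\<^sub>F t in at_right 0. 0 < (x0 + t *\<^sub>R h) $ j"
      by (rule order_tendstoD)
    then show ?thesis
      by (rule eventually_mono) simp
  qed
  then have "\<forall>\<^sub>F t in at_right 0. \<forall>j. 0 \<le> (x0 + t *\<^sub>R h) $ j"
    by (rule eventually_all_finite)
  then have "\<forall>\<^sub>F t in at_right 0. 0 < t \<and> (\<forall>j. 0 \<le> (x0 + t *\<^sub>R h) $ j)"
    by (rule eventually_conj[OF eventually_at_right_less])
  then obtain t where t: "0 < t" "\<forall>j. 0 \<le> (x0 + t *\<^sub>R h) $ j"
    using eventually_happens'[OF trivial_limit_at_right_real] by blast
  have "A *v (x0 + t *\<^sub>R h) = b"
    using x0(1) assms(2) by (simp add: matrix_vector_right_distrib matrix_vector_mult_scaleR)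
  with t(2) have "x0 + t *\<^sub>R h \<in> lp_feasible A b"
    by (simp add: lp_feasible_def)
  with t(1) show ?thesis by (rule that)
qed

lemma riovlp_feasible_imp_dual_feasible:
  fixes A :: "real ^ 'n ^ 'm"
  assumes "x0 \<in> lp_feasible A b" and "riovlp_feasible A b x0 K c'"
  obtains p where "dual_feasible A x0 K p c'"
proof -
  \<comment> \<open>Rows enter with both signs because the dual vector is free in sign; the unit
    vectors generate the slacks, allowed only where \<open>x0\<close> vanishes.\<close>
  define S where "S = range (\<lambda>i. row i A) \<union> range (\<lambda>i. - row i A) \<union> (\<lambda>j. axis j 1) ` {j. x0 $ j = 0}"
  \<comment> \<open>The dual constraints without the value condition
    \<open>c' \<bullet> x0 = K\<close>, which is not homogeneous: \<open>Z\<close> is thus a convex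
    cone, and minimality of the hull gives a dual vector without writing out conic
    coefficients.\<close>
  define Z where "Z = {y. \<exists>p. \<forall>j. p \<bullet> column j A \<le> y $ j \<and>
    (x0 $ j \<noteq> 0 \<longrightarrow> p \<bullet> column j A = y $ j)}"
  have c': "c' \<bullet> x0 = K" and opt: "\<And>x. x \<in> lp_feasible A b \<Longrightarrow> K \<le> c' \<bullet> x"
    using assms(2) by (auto simp: riovlp_feasible_def is_min_value_def is_arg_min_def not_less)
  have "c' \<in> convex_cone hull S"
  proof (rule ccontr)
    assume "c' \<notin> convex_cone hull S"
    moreover have "finite S"
      by (simp add: S_def)
    ultimately obtain h where h: "h \<bullet> c' < 0" "\<And>x. x \<in> S \<Longrightarrow> 0 \<le> h \<bullet> x"
      using farkas_convex_cone_hull by blast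
    have "h \<bullet> row i A = 0" for i
      using h(2)[of "row i A"] h(2)[of "- row i A"] by (auto simp: S_def)
    then have "A *v h = 0"
      by (simp add: vec_eq_iff matrix_vector_mul_component row_def inner_commute)
    moreover have "0 \<le> h $ j" if "x0 $ j = 0" for j
      using h(2)[of "axis j 1"] that by (auto simp: S_def inner_axis)
    ultimately obtain t where t: "0 < t" "x0 + t *\<^sub>R h \<in> lp_feasible A b"
      using lp_feasible_small_step[OF assms(1)] by blast
    have "K \<le> K + t * (h \<bullet> c')"
      using opt[OF t(2)] c' by (simp add: inner_add_right inner_commute)
    with t(1) h(1) show False
      by (simp add: zero_le_mult_iff)
  qed
  also have "convex_cone hull S \<subseteq> Z"
  proof (rule hull_minimal)
    \<comment> \<open>The witness \<open>axis i r\<close> selects \<open>r\<close> times row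
      \<open>i\<close>, so all slacks are zero; \<open>r = 1\<close> and \<open>r = -1\<close> give
      the two kinds of row generators.\<close>
    have row: "r *\<^sub>R row i A \<in> Z" for r i
      unfolding Z_def
      by (auto intro!: exI[of _ "axis i r"] simp: inner_axis' row_def column_def)
    have "row i A \<in> Z" "- row i A \<in> Z" for i
      using row[of 1 i] row[of "-1" i] by simp_all
    moreover have "axis j 1 \<in> Z" if "x0 $ j = 0" for j
      unfolding Z_def using that by (auto intro!: exI[of _ 0] simp: axis_def)
    ultimately show "S \<subseteq> Z"
      by (auto simp: S_def)
    have "0 \<in> Z"
      by (auto simp: Z_def intro!: exI[of _ 0])
    moreover have "x + y \<in> Z" if xy: "x \<in> Z" "y \<in> Z" for x y
    proof -
      from xy obtain p q where
        "\<forall>j. p \<bullet> column j A \<le> x $ j \<and> (x0 $ j \<noteq> 0 \<longrightarrow> p \<bullet> column j A = x $ j)"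
        "\<forall>j. q \<bullet> column j A \<le> y $ j \<and> (x0 $ j \<noteq> 0 \<longrightarrow> q \<bullet> column j A = y $ j)"
        unfolding Z_def by blast
      then show ?thesis
        unfolding Z_def
        by (auto intro!: exI[of _ "p + q"] add_mono simp: inner_add_left)
    qed
    moreover have "r *\<^sub>R x \<in> Z" if x: "x \<in> Z" and "0 \<le> r" for r x
    proof -
      from x obtain p where
        "\<forall>j. p \<bullet> column j A \<le> x $ j \<and> (x0 $ j \<noteq> 0 \<longrightarrow> p \<bullet> column j A = x $ j)"
        unfolding Z_def by blast
      with \<open>0 \<le> r\<close> show ?thesis
        unfolding Z_def
        by (auto intro!: exI[of _ "r *\<^sub>R p"] mult_left_mono)
    qed
    ultimately show "convex_cone Z"
      by (auto simp: convex_cone_iff)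
  qed
  finally obtain p where "\<forall>j. p \<bullet> column j A \<le> c' $ j \<and>
      (x0 $ j \<noteq> 0 \<longrightarrow> p \<bullet> column j A = c' $ j)"
    unfolding Z_def by blast
  with c' have "dual_feasible A x0 K p c'"
    by (auto simp: dual_feasible_def)
  then show ?thesis by (rule that)
qed

text \<open>Weak duality with reduced costs \<open>s\<close>: on \<open>A *v x = b\<close> the cost
  is the constant \<open>p \<bullet> b\<close> plus \<open>s \<bullet> x\<close>. The second term is
  nonnegative on the feasible set and vanishes at \<open>x0\<close> by complementary
  slackness.\<close>

lemma dual_feasible_imp_riovlp_feasible:
  fixes A :: "real ^ 'n ^ 'm"
  assumes "x0 \<in> lp_feasible A b" and "dual_feasible A x0 K p c'"
  shows "riovlp_feasible A b x0 K c'"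
proof -
  define s where "s = c' - p v* A"
  have s_nth: "s $ j = c' $ j - p \<bullet> column j A" for j
    by (simp add: s_def vector_matrix_mult_def inner_vec_def column_def mult.commute)
  have x0: "A *v x0 = b" "\<And>j. 0 \<le> x0 $ j"
    using assms(1) by (auto simp: lp_feasible_def)
  have s: "0 \<le> s $ j \<and> s $ j * x0 $ j = 0" for j
    using assms(2) x0(2)[of j] unfolding s_nth dual_feasible_def
    by (cases "x0 $ j = 0") (simp_all add: less_le)
  have cost: "c' \<bullet> x = p \<bullet> b + s \<bullet> x" if "A *v x = b" for x
    using that by (simp add: s_def inner_diff_left dot_lmul_matrix)
  have "s \<bullet> x0 = 0"
    by (simp add: inner_vec_def s)
  moreover have "0 \<le> s \<bullet> x" if "x \<in> lp_feasible A b" for x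
    using that s by (auto simp: lp_feasible_def inner_vec_def intro!: sum_nonneg)
  ultimately have "c' \<bullet> x0 \<le> c' \<bullet> x" if "x \<in> lp_feasible A b" for x
    using that x0(1) cost by (auto simp: lp_feasible_def)
  moreover have "c' \<bullet> x0 = K"
    using assms(2) by (simp add: dual_feasible_def)
  ultimately show ?thesis
    using assms(1)
    by (auto simp: riovlp_feasible_def is_min_value_def is_arg_min_def not_less intro!: exI[of _ x0])
qed

theorem theorem1:
  fixes A :: "real ^ 'n ^ 'm" and b :: "real ^ 'm"
    and c d x0 :: "real ^ 'n" and K :: real
    and pi_star :: "real ^ 'm" and c_star :: "real ^ 'n"
  assumes "CARD('m) < CARD('n)"
    and "\<And>j. d $ j > 0"
    and "x0 \<in> lp_feasible A b"
    and "dual_problem_optimal A c d x0 K pi_star c_star"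
  shows "riovlp1_optimal A b c d x0 K c_star"
proof -
  have "dual_feasible A x0 K pi_star c_star"
    and "\<And>q e. dual_feasible A x0 K q e \<Longrightarrow> weighted_l1_cost d c c_star \<le> weighted_l1_cost d c e"
    using assms(4) by (auto simp: dual_problem_optimal_def is_arg_min_def not_less)
  \<comment> \<open>The objective ignores the dual vector, so any \<open>p\<close> paired with
    \<open>e\<close> lets the minimality over pairs bound the cost of \<open>e\<close>.\<close>
  moreover have "\<exists>p. dual_feasible A x0 K p e" if "riovlp_feasible A b x0 K e" for e
    using riovlp_feasible_imp_dual_feasible[OF assms(3) that] by blast
  ultimately show ?thesis
    using dual_feasible_imp_riovlp_feasible[OF assms(3)]
    by (fastforce simp: riovlp1_optimal_def is_arg_min_def not_less)
qed

end
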